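(* Let $H$ be a fixed graph without isolated vertices, let $p\in(0,1)$ be a constant and let $C>0$. Suppose that for every $n\in\mathbb{N}$ we are given a weakly $(K_n,H)$-saturated graph $F^0_n$ on the vertex set $[n]$ containing a set of vertices $S^0_n$ with $|S^0_n|\le C$ such that every vertex of $[n]\setminus S^0_n$ is adjacent in $F^0_n$ to at least $\delta(H)-1$ vertices of $S^0_n$. Then with high probability there exists a subgraph $F_n\subset G(n,p)$ which is weakly $(G(n,p),H)$-saturated and has exactly $\min\{|E(G(n,p))|,|E(F^0_n)|\}$ edges.
   Context: $K_n$ denotes the complete graph on $[n]=\{1,\dots,n\}$, $\delta(H)$ the minimum degree of $H$, and $G(n,p)$ the binomial random graph on $[n]$ in which each pair of distinct vertices is adjacent independently with probability $p$. For graphs $G$ and $H$, a spanning subgraph $F\subset G$ is weakly $(G,H)$-saturated if there is an ordering $e_1,\dots,e_m$ of the edges of $G\setminus F$ such that for every $i\in[m]$ the graph $F\cup\{e_1,\dots,e_i\}$ contains a copy of $H$ containing the edge $e_i$. A property holds with high probability (whp) if its probability tends to $1$ as $n\to\infty$. *)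

theory Defs
  imports "HOL-Probability.Probability"
begin

(* A graph is a pair of a vertex set and a set of two-element vertex sets. *)
type_synonym 'a sgraph = "'a set \<times> 'a set set"

definition verts :: "'a sgraph \<Rightarrow> 'a set" where
  "verts G = fst G"

definition edges :: "'a sgraph \<Rightarrow> 'a set set" where
  "edges G = snd G"

definition simple_graph :: "'a sgraph \<Rightarrow> bool" where
  "simple_graph G \<longleftrightarrow>
     finite (verts G) \<and> verts G \<noteq> {} \<and> (\<forall>e\<in>edges G. e \<subseteq> verts G \<and> card e = 2)"

definition adjacent :: "'a sgraph \<Rightarrow> 'a \<Rightarrow> 'a \<Rightarrow> bool" where
  "adjacent G u v \<longleftrightarrow> {u, v} \<in> edges G"

definition vdegree :: "'a sgraph \<Rightarrow> 'a \<Rightarrow> nat" where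
  "vdegree G v = card {u \<in> verts G. adjacent G v u}"

definition min_degree :: "'a sgraph \<Rightarrow> nat" where
  "min_degree G = Min (vdegree G ` verts G)"

definition no_isolated_vertices :: "'a sgraph \<Rightarrow> bool" where
  "no_isolated_vertices G \<longleftrightarrow> (\<forall>v\<in>verts G. \<exists>u\<in>verts G. adjacent G v u)"

definition complete_on :: "nat \<Rightarrow> nat sgraph" where
  "complete_on n = ({1..n}, {e. e \<subseteq> {1..n} \<and> card e = 2})"

definition subgraph :: "'a sgraph \<Rightarrow> 'a sgraph \<Rightarrow> bool" where
  "subgraph F G \<longleftrightarrow> verts F \<subseteq> verts G \<and> edges F \<subseteq> edges G"

definition spanning_subgraph :: "'a sgraph \<Rightarrow> 'a sgraph \<Rightarrow> bool" where
  "spanning_subgraph F G \<longleftrightarrow> subgraph F G \<and> verts F = verts G"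

definition graph_iso :: "'a sgraph \<Rightarrow> 'b sgraph \<Rightarrow> bool" where
  "graph_iso G H \<longleftrightarrow>
     (\<exists>f. bij_betw f (verts G) (verts H) \<and>
          (\<forall>u\<in>verts G. \<forall>v\<in>verts G. adjacent G u v \<longleftrightarrow> adjacent H (f u) (f v)))"

(* Copies are subgraphs, not necessarily induced. *)
definition copy_of_in :: "'a sgraph \<Rightarrow> 'h sgraph \<Rightarrow> 'a sgraph \<Rightarrow> bool" where
  "copy_of_in H' H G \<longleftrightarrow> simple_graph H' \<and> subgraph H' G \<and> graph_iso H H'"

definition add_edges :: "'a sgraph \<Rightarrow> 'a set set \<Rightarrow> 'a sgraph" where
  "add_edges F D = (verts F, edges F \<union> D)"

definition weakly_saturated :: "'a sgraph \<Rightarrow> 'h sgraph \<Rightarrow> 'a sgraph \<Rightarrow> bool" where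
  "weakly_saturated G H F \<longleftrightarrow>
     spanning_subgraph F G \<and>
     (\<exists>es. distinct es \<and> set es = edges G - edges F \<and>
        (\<forall>i<length es. \<exists>H'.
           copy_of_in H' H (add_edges F (set (take (Suc i) es))) \<and> es ! i \<in> edges H'))"

definition gnp :: "nat \<Rightarrow> real \<Rightarrow> nat sgraph pmf" where
  "gnp n p =
     map_pmf (\<lambda>X. ({1..n}, {e \<in> edges (complete_on n). X e}))
       (Pi_pmf (edges (complete_on n)) False (\<lambda>_. bernoulli_pmf p))"

end

theory Submission
  imports Defs "HOL-Real_Asymp.Real_Asymp"
begin

text \<open>Let \<open>d = \<delta>(H) - 1\<close>. The hypothesis on \<open>S\<^sup>0\<^sub>n\<close> gives \<open>|E(F\<^sup>0\<^sub>n)| \<ge> d (n - C)\<close>, so the excess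
  \<open>|E(F\<^sup>0\<^sub>n)| - d n\<close> is bounded below and is minimised at some fixed \<open>m \<ge> |V(H)|\<close>. With high
  probability every set of at most \<open>k\<close> vertices of \<open>G(n,p)\<close> has a common neighbour, where
  \<open>k = m + 2|V(H)| + 2\<close> does not depend on \<open>n\<close>. In such a graph choose a clique \<open>K\<close> of size \<open>m\<close>, let
  \<open>A\<close> be the common neighbourhood of \<open>K\<close>, and put a copy of \<open>F\<^sup>0\<^sub>m\<close> on \<open>K\<close>. Attach each vertex of \<open>A\<close>
  by \<open>d\<close> edges to \<open>K\<close>, and every other vertex by \<open>d\<close> edges to a clique inside \<open>A\<close>. This graph has at
  most \<open>|E(F\<^sup>0\<^sub>m)| + d (n - m) \<le> |E(F\<^sup>0\<^sub>n)|\<close> edges. It generates, in this order, the edges inside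
  \<open>K\<close>, between \<open>A\<close> and \<open>K\<close>, inside \<open>A\<close>, between \<open>A\<close> and the rest, and finally all others;
  edges of \<open>G(n,p)\<close> are then added to reach the exact count.\<close>

section \<open>The closure under completing copies\<close>

definition map_graph :: "('a \<Rightarrow> 'b) \<Rightarrow> 'a sgraph \<Rightarrow> 'b sgraph" where
  "map_graph f G = (f ` verts G, (`) f ` edges G)"

lemma verts_map_graph [simp]: "verts (map_graph f G) = f ` verts G"
  and edges_map_graph [simp]: "edges (map_graph f G) = (`) f ` edges G"
  by (simp_all add: map_graph_def verts_def edges_def)

lemma verts_add_edges [simp]: "verts (add_edges F D) = verts F"
  and edges_add_edges [simp]: "edges (add_edges F D) = edges F \<union> D"
  by (simp_all add: add_edges_def verts_def edges_def)

lemma simple_graph_edgeD: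
  assumes "simple_graph G" "e \<in> edges G"
  shows "e \<subseteq> verts G" "card e = 2"
  using assms by (auto simp: simple_graph_def)

lemma simple_graph_finite_edges:
  assumes "simple_graph G"
  shows "finite (edges G)"
proof (rule finite_subset)
  show "edges G \<subseteq> Pow (verts G)" "finite (Pow (verts G))"
    using assms by (auto simp: simple_graph_def)
qed

lemma verts_complete_on [simp]: "verts (complete_on n) = {1..n}"
  and edges_complete_on: "edges (complete_on n) = {e. e \<subseteq> {1..n} \<and> card e = 2}"
  by (simp_all add: complete_on_def verts_def edges_def)

lemma pair_in_edges_complete_on:
  "{a, b} \<in> edges (complete_on n) \<longleftrightarrow> a \<in> {1..n} \<and> b \<in> {1..n} \<and> a \<noteq> b"
  by (auto simp: edges_complete_on card_insert_if)

lemma finite_edges_complete_on: "finite (edges (complete_on n))"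
  unfolding edges_complete_on by (rule finite_subset[of _ "Pow {1..n}"]) auto

lemma adjacentD:
  assumes "simple_graph G" "adjacent G u v"
  shows "u \<in> verts G" "v \<in> verts G" "u \<noteq> v"
  using simple_graph_edgeD[OF assms(1), of "{u, v}"] assms(2) by (auto simp: adjacent_def)

lemma simple_graph_map_graph:
  assumes "simple_graph G" "inj_on f (verts G)"
  shows "simple_graph (map_graph f G)"
  using assms unfolding simple_graph_def
  by (auto simp: card_image inj_on_subset)

lemma graph_iso_map_graph:
  assumes "simple_graph G" "inj_on f (verts G)"
  shows "graph_iso G (map_graph f G)"
  unfolding graph_iso_def
proof (intro exI[of _ f] conjI ballI)
  show "bij_betw f (verts G) (verts (map_graph f G))"
    using assms(2) by (simp add: bij_betw_def)
  fix u v assume uv: "u \<in> verts G" "v \<in> verts G"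
  have "{u, v} \<in> edges G" if e: "e \<in> edges G" "f ` e = {f u, f v}" for e
  proof -
    have "f ` e = f ` {u, v}" "e \<subseteq> verts G"
      using e simple_graph_edgeD[OF assms(1)] by auto
    then have "e = {u, v}"
      using uv inj_on_image_eq_iff[OF assms(2), of e "{u, v}"] by simp
    with e show ?thesis by simp
  qed
  moreover have "f ` {u, v} \<in> (`) f ` edges G" if "{u, v} \<in> edges G"
    using that by (rule imageI)
  ultimately show "adjacent G u v \<longleftrightarrow> adjacent (map_graph f G) (f u) (f v)"
    unfolding adjacent_def edges_map_graph by auto
qed

lemma graph_iso_trans:
  assumes "graph_iso G H" "graph_iso H J"
  shows "graph_iso G J"
proof -
  from assms obtain f g where
    f: "bij_betw f (verts G) (verts H)"
       "\<forall>u\<in>verts G. \<forall>v\<in>verts G. adjacent G u v \<longleftrightarrow> adjacent H (f u) (f v)" and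
    g: "bij_betw g (verts H) (verts J)"
       "\<forall>u\<in>verts H. \<forall>v\<in>verts H. adjacent H u v \<longleftrightarrow> adjacent J (g u) (g v)"
    unfolding graph_iso_def by blast
  show ?thesis unfolding graph_iso_def
    by (intro exI[of _ "g \<circ> f"] conjI bij_betw_trans[OF f(1) g(1)])
      (use f g bij_betwE[OF f(1)] in auto)
qed

lemma copy_of_in_map_graph:
  assumes "copy_of_in H' H G" "simple_graph J" "inj_on f (verts G)" "f ` verts G \<subseteq> verts J"
    and "\<And>e. e \<in> edges G \<Longrightarrow> f ` e \<in> edges J"
  shows "copy_of_in (map_graph f H') H J"
proof -
  have H': "simple_graph H'" "verts H' \<subseteq> verts G" "edges H' \<subseteq> edges G" "graph_iso H H'"
    using assms(1) by (auto simp: copy_of_in_def subgraph_def)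
  have inj: "inj_on f (verts H')"
    using H'(2) assms(3) by (rule inj_on_subset[rotated])
  show ?thesis
    unfolding copy_of_in_def subgraph_def
    using simple_graph_map_graph[OF H'(1) inj]
      graph_iso_trans[OF H'(4) graph_iso_map_graph[OF H'(1) inj]] H' assms(4,5) by auto
qed

text \<open>An order-free form of the saturation process: being generated does not depend on when an
  edge appears, so edges can be proved generated one by one and the results combined freely. The
  copy only has to lie in \<open>G\<close>; the premise of \<open>step\<close> demands that all its
  other edges are generated already.\<close>

inductive_set sat_closure :: "'a sgraph \<Rightarrow> 'h sgraph \<Rightarrow> 'a set set \<Rightarrow> 'a set set"
  for G :: "'a sgraph" and H :: "'h sgraph" and D :: "'a set set"
  where
    base: "e \<in> D \<Longrightarrow> e \<in> sat_closure G H D"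
  | step: "copy_of_in H' H G \<Longrightarrow> e \<in> edges H' \<Longrightarrow>
      \<forall>e'. e' \<in> edges H' - {e} \<longrightarrow> e' \<in> sat_closure G H D \<Longrightarrow> e \<in> sat_closure G H D"

lemma sat_closure_subset_edges:
  assumes "D \<subseteq> edges G"
  shows "sat_closure G H D \<subseteq> edges G"
proof
  fix e assume "e \<in> sat_closure G H D"
  then show "e \<in> edges G"
    by induction (use assms in \<open>auto simp: copy_of_in_def subgraph_def\<close>)
qed

lemma sat_closure_mono:
  assumes "D \<subseteq> D'"
  shows "sat_closure G H D \<subseteq> sat_closure G H D'"
proof
  fix e assume "e \<in> sat_closure G H D"
  then show "e \<in> sat_closure G H D'"
    by induction (use assms in \<open>auto intro: sat_closure.intros\<close>)
qed

text \<open>An injective homomorphism carries copies of \<open>H\<close> to copies of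
  \<open>H\<close>, so a whole derivation can be replayed in \<open>J\<close>, which may have
  further edges. This moves the process on the complete graph on \<open>m\<close> vertices to a
  clique of a larger graph.\<close>

lemma sat_closure_map:
  assumes "e \<in> sat_closure G H D" "simple_graph J" "inj_on f (verts G)" "f ` verts G \<subseteq> verts J"
    and "\<And>e. e \<in> edges G \<Longrightarrow> f ` e \<in> edges J"
  shows "f ` e \<in> sat_closure J H ((`) f ` D)"
  using assms(1)
proof induction
  case (base e)
  then show ?case by (auto intro: sat_closure.base)
next
  case (step H' e)
  show ?case
    by (rule sat_closure.step[OF copy_of_in_map_graph[OF step(1) assms(2-5)]])
      (use step in auto)
qed

lemma weakly_saturated_imp_sat_closure:
  assumes "weakly_saturated G H F"
  shows "edges G \<subseteq> sat_closure G H (edges F)"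
proof -
  from assms obtain es where sp: "spanning_subgraph F G"
    and es: "set es = edges G - edges F"
    and copies: "\<And>i. i < length es \<Longrightarrow> \<exists>H'. copy_of_in H' H (add_edges F (set (take (Suc i) es)))
      \<and> es ! i \<in> edges H'"
    unfolding weakly_saturated_def by blast
  have "es ! i \<in> sat_closure G H (edges F)" if "i < length es" for i
    using that
  proof (induction i rule: less_induct)
    case (less i)
    obtain H' where H': "copy_of_in H' H (add_edges F (set (take (Suc i) es)))" "es ! i \<in> edges H'"
      using copies[OF less.prems] by blast
    have "set (take (Suc i) es) \<subseteq> edges G"
      using es set_take_subset[of "Suc i" es] by blast
    then have copy: "copy_of_in H' H G"
      using H'(1) sp by (auto simp: copy_of_in_def subgraph_def spanning_subgraph_def)
    have "e \<in> sat_closure G H (edges F)" if e: "e \<in> edges H' - {es ! i}" for e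
    proof -
      have "e \<in> edges F \<or> e \<in> set (take (Suc i) es)"
        using e H'(1) by (auto simp: copy_of_in_def subgraph_def)
      moreover have "e \<in> sat_closure G H (edges F)" if "e \<in> set (take i es)"
        using that less by (auto simp: in_set_conv_nth)
      ultimately show ?thesis
        using e less.prems by (auto simp: take_Suc_conv_app_nth intro: sat_closure.base)
    qed
    then show ?case using sat_closure.step[OF copy H'(2)] by blast
  qed
  then have "set es \<subseteq> sat_closure G H (edges F)"
    by (metis in_set_conv_nth subsetI)
  then show ?thesis
    using es by (auto intro: sat_closure.base)
qed

text \<open>The ordering is built from the front, by induction on the number of missing edges: some
  edge can always be completed at once, and adding it to \<open>F\<close> only enlarges the
  closure.\<close>

lemma sat_closure_imp_weakly_saturated:
  assumes "simple_graph G" "spanning_subgraph F G" "edges G \<subseteq> sat_closure G H (edges F)"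
  shows "weakly_saturated G H F"
  using assms(2,3)
proof (induction "card (edges G - edges F)" arbitrary: F)
  case 0
  then have "edges G - edges F = {}"
    using simple_graph_finite_edges[OF assms(1)] by simp
  then show ?case
    unfolding weakly_saturated_def using 0(2) by (intro conjI exI[of _ "[]"]) auto
next
  case (Suc N)
  have F: "verts F = verts G" "edges F \<subseteq> edges G"
    using Suc.prems by (auto simp: spanning_subgraph_def subgraph_def)
  \<comment> \<open>If no copy in \<open>G\<close> lacked exactly one edge of \<open>F\<close>, then
    \<open>edges F\<close> would be closed under \<open>step\<close>, so it would contain the
    closure and hence every edge of \<open>G\<close>.\<close>
  have "\<exists>H' e. copy_of_in H' H G \<and> e \<in> edges H' \<and> edges H' - {e} \<subseteq> edges F \<and> e \<notin> edges F"
  proof (rule ccontr)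
    assume none: "\<not> ?thesis"
    have "e \<in> edges F" if "e \<in> sat_closure G H (edges F)" for e
      using that
    proof induction
      case (step H' e)
      then show ?case using none by blast
    qed
    then have "edges G - edges F = {}" using Suc.prems(2) by blast
    then show False using Suc.hyps(2) by (metis card.empty nat.distinct(1))
  qed
  then obtain H' e where H': "copy_of_in H' H G" "e \<in> edges H'"
      "edges H' - {e} \<subseteq> edges F" "e \<notin> edges F"
    by blast
  define F1 where "F1 = add_edges F {e}"
  have eG: "e \<in> edges G" using H' by (auto simp: copy_of_in_def subgraph_def)
  have "edges G - edges F1 = (edges G - edges F) - {e}"
    by (auto simp: F1_def)
  then have "N = card (edges G - edges F1)"
    using Suc.hyps(2) eG H'(4) by simp
  moreover have "spanning_subgraph F1 G"
    using F eG by (auto simp: spanning_subgraph_def subgraph_def F1_def)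
  moreover have "edges G \<subseteq> sat_closure G H (edges F1)"
    using Suc.prems(2) sat_closure_mono[of "edges F" "edges F1" G H] by (auto simp: F1_def)
  ultimately have "weakly_saturated G H F1" by (rule Suc.hyps(1))
  then obtain es where es: "distinct es" "set es = edges G - edges F1"
    and copies: "\<And>i. i < length es \<Longrightarrow> \<exists>H'. copy_of_in H' H (add_edges F1 (set (take (Suc i) es)))
      \<and> es ! i \<in> edges H'"
    unfolding weakly_saturated_def by blast
  have "\<exists>H'. copy_of_in H' H (add_edges F (set (take (Suc i) (e # es)))) \<and> (e # es) ! i \<in> edges H'"
    if "i < length (e # es)" for i
  proof (cases i)
    case 0
    have "copy_of_in H' H (add_edges F {e})"
      using H' F by (auto simp: copy_of_in_def subgraph_def)
    then show ?thesis using 0 H'(2) by (intro exI[of _ H']) simp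
  next
    case (Suc j)
    have "add_edges F1 (set (take (Suc j) es)) = add_edges F (set (take (Suc i) (e # es)))"
      by (simp add: Suc F1_def add_edges_def verts_def edges_def)
    then show ?thesis using copies[of j] Suc that by simp
  qed
  moreover have "distinct (e # es)" "set (e # es) = edges G - edges F"
    using es eG H'(4) by (auto simp: F1_def)
  ultimately show ?case
    unfolding weakly_saturated_def using Suc.prems(1) by blast
qed

section \<open>Completing a single edge next to a generated clique\<close>

lemma bij_betw_extend:
  assumes "bij_betw f A C" "bij_betw g B D" "A \<inter> B = {}" "C \<inter> D = {}"
  shows "bij_betw (\<lambda>x. if x \<in> A then f x else g x) (A \<union> B) (C \<union> D)"
proof (rule bij_betw_combine[OF _ _ assms(4)])
  show "bij_betw (\<lambda>x. if x \<in> A then f x else g x) A C"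
    using assms(1) by (simp cong: bij_betw_cong)
  show "bij_betw (\<lambda>x. if x \<in> A then f x else g x) B D"
    using assms(2,3) by (subst bij_betw_cong[of _ _ g]) auto
qed

text \<open>A copy of \<open>H\<close> completing \<open>{v, w}\<close> sends \<open>x\<close> to \<open>v\<close>, one neighbour of \<open>x\<close> to \<open>w\<close>, and the
  remaining neighbours of \<open>x\<close> onto \<open>U\<close>.\<close>

lemma sat_closure_star:
  assumes H: "simple_graph H" "x \<in> verts H" "0 < vdegree H x"
    and G: "simple_graph G" and D: "D \<subseteq> edges G"
    and B: "B \<subseteq> verts G" "card (verts H) - 1 \<le> card B"
    and v: "v \<in> verts G" "v \<notin> B"
    and U: "U \<subseteq> B" "card U = vdegree H x - 1"
    and w: "w \<in> B" "w \<notin> U" "{v, w} \<in> edges G"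
    and clB: "\<And>a b. a \<in> B \<Longrightarrow> b \<in> B \<Longrightarrow> a \<noteq> b \<Longrightarrow> {a, b} \<in> sat_closure G H D"
    and clU: "\<And>u. u \<in> U \<Longrightarrow> {v, u} \<in> sat_closure G H D"
  shows "{v, w} \<in> sat_closure G H D"
proof -
  define N where "N = {u \<in> verts H. adjacent H x u}"
  have finH: "finite (verts H)" and finG: "finite (verts G)"
    using H(1) G by (auto simp: simple_graph_def)
  have N: "N \<subseteq> verts H - {x}" "finite N" "card N = vdegree H x"
    using finH adjacentD(3)[OF H(1), of x x] by (auto simp: N_def vdegree_def)
  then obtain y where y: "y \<in> N" using H(3) by fastforce
  have cardN: "card N \<le> card (verts H) - 1"
    using card_mono[OF _ N(1)] finH H(2) by simp
  have finB: "finite B" using B(1) finG by (rule finite_subset)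
  have "card (insert w U) = vdegree H x"
    using U w finite_subset[OF U(1) finB] H(3) by simp
  \<comment> \<open>Together with \<open>v\<close>, the set \<open>B'\<close> has exactly as many
    vertices as \<open>H\<close> and becomes the vertex set of the copy.\<close>
  then obtain B' where B': "insert w U \<subseteq> B'" "B' \<subseteq> B" "card B' = card (verts H) - 1"
    using exists_subset_between[of "insert w U" "card (verts H) - 1" B] U w B(2) finB cardN N(3)
    by auto
  have finB': "finite B'" "finite U" using B' finB finite_subset U by blast+
  have "card (N - {y}) = card U"
    using y N U by simp
  then obtain f1 where f1: "bij_betw f1 (N - {y}) U"
    using finite_same_card_bij[of "N - {y}" U] N(2) finB'(2) by auto
  have "card (verts H - {x} - N) = card (verts H) - 1 - vdegree H x"
    using N finH H(2) by (simp add: card_Diff_subset)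
  moreover have "card (B' - insert w U) = card (verts H) - 1 - vdegree H x"
    using B' finB' card_Diff_subset[of "insert w U" B'] \<open>card (insert w U) = vdegree H x\<close> by simp
  ultimately have "card (verts H - {x} - N) = card (B' - insert w U)" by simp
  then obtain f2 where f2: "bij_betw f2 (verts H - {x} - N) (B' - insert w U)"
    using finite_same_card_bij[of "verts H - {x} - N" "B' - insert w U"] finH finB'(1) by auto
  have g1: "bij_betw (\<lambda>z. if z \<in> N - {y} then f1 z else f2 z)
     ((N - {y}) \<union> (verts H - {x} - N)) (U \<union> (B' - insert w U))" (is "bij_betw ?g1 _ _")
    by (rule bij_betw_extend[OF f1 f2]) auto
  define f where "f = (\<lambda>z. if z = x then v else if z = y then w else ?g1 z)"
  have xy: "x \<noteq> y" using y N by auto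
  have dom: "verts H = {x} \<union> ({y} \<union> ((N - {y}) \<union> (verts H - {x} - N)))"
    using y N H(2) by auto
  have ran: "insert v B' = {v} \<union> ({w} \<union> (U \<union> (B' - insert w U)))"
    using B' by auto
  have f_eq: "f = (\<lambda>z. if z \<in> {x} then v else if z \<in> {y} then w else ?g1 z)"
    by (auto simp: f_def fun_eq_iff)
  have "bij_betw f ({x} \<union> ({y} \<union> ((N - {y}) \<union> (verts H - {x} - N))))
      ({v} \<union> ({w} \<union> (U \<union> (B' - insert w U))))"
    unfolding f_eq
  proof (intro bij_betw_extend g1)
    show "bij_betw (\<lambda>_. v) {x} {v}" "bij_betw (\<lambda>_. w) {y} {w}" by simp_all
  qed (use w v B' xy U y N(1) f1 f2 in auto)
  then have f: "bij_betw f (verts H) (insert v B')"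
    unfolding dom[symmetric] ran[symmetric] .
  have inj: "inj_on f (verts H)" and img: "f ` verts H = insert v B'"
    using f by (auto simp: bij_betw_def)
  have fU: "f z \<in> U" if "z \<in> N" "z \<noteq> y" for z
    using that N f1 by (auto simp: f_def bij_betw_def)
  have fB: "f z \<in> B'" if "z \<in> verts H" "z \<noteq> x" for z
  proof -
    have "f z \<noteq> f x" using that inj H(2) by (auto dest: inj_onD)
    moreover have "f z \<in> insert v B'" using img that by blast
    ultimately show ?thesis by (simp add: f_def)
  qed
  \<comment> \<open>Edges at \<open>x\<close> other than \<open>{x, y}\<close> land between
    \<open>v\<close> and \<open>U\<close>, where \<open>clU\<close> applies; edges avoiding
    \<open>x\<close> land inside \<open>B'\<close>, where \<open>clB\<close> applies. Only
    \<open>{x, y}\<close>, with image \<open>{v, w}\<close>, is left.\<close>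
  have cl: "f ` e \<in> sat_closure G H D" if e: "e \<in> edges H" "e \<noteq> {x, y}" for e
  proof -
    obtain a b where ab: "e = {a, b}" "a \<noteq> b" "a \<in> verts H" "b \<in> verts H"
      using simple_graph_edgeD[OF H(1) e(1)] by (auto simp: card_2_iff)
    have star: "{f x, f c} \<in> sat_closure G H D" if "{x, c} \<in> edges H" "{x, c} \<noteq> {x, y}" for c
    proof -
      have "c \<in> N" "c \<noteq> y"
        using that adjacentD(2)[OF H(1), of x c] by (auto simp: N_def adjacent_def)
      then show ?thesis using clU[OF fU] by (simp add: f_def)
    qed
    consider "a = x" | "b = x" | "a \<noteq> x" "b \<noteq> x" by blast
    then show ?thesis
    proof cases
      case 1 then show ?thesis using star[of b] e ab by auto
    next
      case 2 then show ?thesis using star[of a] e ab by (auto simp: insert_commute)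
    next
      case 3
      have "f a \<noteq> f b" using inj ab by (auto dest: inj_onD)
      then show ?thesis using clB[of "f a" "f b"] fB[of a] fB[of b] 3 ab B'(2) by auto
    qed
  qed
  have xyE: "{x, y} \<in> edges H" using y by (simp add: N_def adjacent_def)
  have fxy: "f ` {x, y} = {v, w}" using xy by (simp add: f_def insert_commute)
  \<comment> \<open>\<open>B\<close> is not assumed to be a clique of \<open>G\<close>; its pairs
    are edges because the closure stays inside \<open>edges G\<close>.\<close>
  have "f ` e \<in> edges G" if "e \<in> edges H" for e
    using cl[OF that] fxy w(3) sat_closure_subset_edges[OF D, of H] by (cases "e = {x, y}") auto
  then have "edges (map_graph f H) \<subseteq> edges G" by auto
  then have copy: "copy_of_in (map_graph f H) H G"
    unfolding copy_of_in_def subgraph_def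
    using simple_graph_map_graph[OF H(1) inj] graph_iso_map_graph[OF H(1) inj] img v B(1) B'(2)
    by auto
  show ?thesis
  proof (rule sat_closure.step[OF copy])
    show "{v, w} \<in> edges (map_graph f H)"
      using imageI[OF xyE, of "(`) f"] unfolding fxy by simp
    show "\<forall>e'. e' \<in> edges (map_graph f H) - {{v, w}} \<longrightarrow> e' \<in> sat_closure G H D"
    proof (intro allI impI)
      fix e' assume "e' \<in> edges (map_graph f H) - {{v, w}}"
      then obtain e where "e \<in> edges H" "e' = f ` e" "f ` e \<noteq> {v, w}" by auto
      then show "e' \<in> sat_closure G H D" using cl[of e] fxy by blast
    qed
  qed
qed

text \<open>The case in which all other edges from \<open>v\<close> to \<open>B\<close> are known:
  then any \<open>vdegree H x - 1\<close> vertices of \<open>B - {w}\<close> serve as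
  \<open>U\<close>, and there are enough of them because \<open>x\<close> has at most
  \<open>card (verts H) - 1\<close> neighbours.\<close>

lemma sat_closure_clique:
  assumes H: "simple_graph H" "x \<in> verts H" "0 < vdegree H x"
    and G: "simple_graph G" and D: "D \<subseteq> edges G"
    and B: "B \<subseteq> verts G" "card (verts H) - 1 \<le> card B"
    and v: "v \<in> verts G" "v \<notin> B"
    and w: "w \<in> B" "{v, w} \<in> edges G"
    and clB: "\<And>a b. a \<in> B \<Longrightarrow> b \<in> B \<Longrightarrow> a \<noteq> b \<Longrightarrow> {a, b} \<in> sat_closure G H D"
    and clv: "\<And>u. u \<in> B \<Longrightarrow> u \<noteq> w \<Longrightarrow> {v, u} \<in> sat_closure G H D"
  shows "{v, w} \<in> sat_closure G H D"
proof -
  have finH: "finite (verts H)" and finG: "finite (verts G)"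
    using H(1) G by (auto simp: simple_graph_def)
  have "{u \<in> verts H. adjacent H x u} \<subseteq> verts H - {x}"
    using adjacentD(3)[OF H(1), of x x] by auto
  then have "vdegree H x \<le> card (verts H) - 1"
    unfolding vdegree_def using card_mono[OF finite_Diff[OF finH], of _ "{x}"] finH H(2) by simp
  then have "vdegree H x - 1 \<le> card (B - {w})"
    using B w finite_subset[OF B(1) finG] by simp
  then obtain U where U: "U \<subseteq> B - {w}" "card U = vdegree H x - 1"
    by (meson obtain_subset_with_card_n)
  have "U \<subseteq> B" "w \<notin> U" using U(1) by auto
  then show ?thesis
    by (rule sat_closure_star[OF H G D B v _ U(2) w(1) _ w(2) clB clv]) (use U(1) in auto)
qed

section \<open>Graphs in which small sets have common neighbours\<close>

text \<open>In a simple graph the vertex \<open>z\<close> lies outside \<open>Q\<close>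
  automatically, as there are no loops. Bounding \<open>card Q\<close> from above, instead of fixing
  it, allows unions of overlapping sets.\<close>

definition extension_property :: "nat \<Rightarrow> 'a sgraph \<Rightarrow> bool" where
  "extension_property k G \<longleftrightarrow>
     (\<forall>Q \<subseteq> verts G. card Q \<le> k \<longrightarrow> (\<exists>z\<in>verts G. \<forall>q\<in>Q. {q, z} \<in> edges G))"

definition clique :: "'a sgraph \<Rightarrow> 'a set \<Rightarrow> bool" where
  "clique G T \<longleftrightarrow> T \<subseteq> verts G \<and> (\<forall>a\<in>T. \<forall>b\<in>T. a \<noteq> b \<longrightarrow> {a, b} \<in> edges G)"

lemma clique_Un:
  assumes "clique G S" "clique G T" "\<And>s t. s \<in> S \<Longrightarrow> t \<in> T \<Longrightarrow> {s, t} \<in> edges G"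
  shows "clique G (S \<union> T)"
proof -
  have "{t, s} \<in> edges G" if "s \<in> S" "t \<in> T" for s t
    using assms(3)[OF that] by (simp add: insert_commute)
  then show ?thesis using assms by (simp add: clique_def ball_Un)
qed

text \<open>\<open>T\<close> grows by one vertex at a time, each a common neighbour of
  \<open>Q\<close> and of the part of \<open>T\<close> found so far.\<close>

lemma extension_property_clique:
  assumes "simple_graph G" "extension_property k G" "Q \<subseteq> verts G" "card Q + j \<le> k"
  obtains T where "clique G T" "card T = j" "\<And>q t. q \<in> Q \<Longrightarrow> t \<in> T \<Longrightarrow> {q, t} \<in> edges G"
proof -
  have "\<exists>T. clique G T \<and> card T = j \<and> (\<forall>q\<in>Q. \<forall>t\<in>T. {q, t} \<in> edges G)"
    using assms(4)
  proof (induction j)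
    case 0
    show ?case by (rule exI[of _ "{}"]) (simp add: clique_def)
  next
    case (Suc j)
    then obtain T where T: "clique G T" "card T = j" "\<forall>q\<in>Q. \<forall>t\<in>T. {q, t} \<in> edges G"
      by auto
    have finT: "finite T"
      using T(1) assms(1) finite_subset by (auto simp: clique_def simple_graph_def)
    have "card (Q \<union> T) \<le> k" "Q \<union> T \<subseteq> verts G"
      using card_Un_le[of Q T] T Suc.prems assms(3) by (auto simp: clique_def)
    then obtain z where z: "z \<in> verts G" "\<forall>q\<in>Q \<union> T. {q, z} \<in> edges G"
      using assms(2) unfolding extension_property_def by blast
    have "{z, z} \<notin> edges G" using simple_graph_edgeD(2)[OF assms(1), of "{z, z}"] by auto
    then have "z \<notin> T" using z(2) by blast
    then have "card (insert z T) = Suc j" using T(2) finT by simp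
    moreover have "clique G (insert z T)"
      using T(1) z unfolding clique_def by (auto simp: insert_commute)
    moreover have "\<forall>q\<in>Q. \<forall>t\<in>insert z T. {q, t} \<in> edges G"
      using T(3) z(2) by blast
    ultimately show ?case by blast
  qed
  then show ?thesis using that by blast
qed

text \<open>With h = \<open>card (verts H)\<close>, the bound
  \<open>m + 2 * card (verts H) + 2\<close> pays for the clique \<open>K\<close> of size
  \<open>m\<close>, a set \<open>Q\<close> of at most h + 2 vertices, and a clique of size h joined
  to both. The conclusion speaks of the closure, which is monotone, so that edges can be added to
  \<open>F\<close> afterwards.\<close>

lemma extension_property_saturated:
  fixes G :: "'a sgraph" and H :: "'h sgraph"
  assumes H: "simple_graph H" "x \<in> verts H" "0 < vdegree H x"
    and G: "simple_graph G"
    and F0: "weakly_saturated (complete_on m) H F0" and m: "card (verts H) \<le> m"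
    and ext: "extension_property (m + 2 * card (verts H) + 2) G"
  obtains F where "spanning_subgraph F G" "edges G \<subseteq> sat_closure G H (edges F)"
    "m \<le> card (verts G)"
    "card (edges F) \<le> card (edges F0) + (vdegree H x - 1) * (card (verts G) - m)"
proof -
  define h where "h = card (verts H)"
  define d where "d = vdegree H x"
  have finH: "finite (verts H)" and finG: "finite (verts G)"
    using H(1) G by (auto simp: simple_graph_def)
  have dh: "d < h"
  proof -
    have "{u \<in> verts H. adjacent H x u} \<subset> verts H"
      using adjacentD(3)[OF H(1), of x x] H(2) by auto
    then show ?thesis unfolding d_def h_def vdegree_def using psubset_card_mono[OF finH] by blast
  qed
  have loop: "u \<noteq> v" and inV: "u \<in> verts G" "v \<in> verts G" if "{u, v} \<in> edges G" for u v
    using simple_graph_edgeD[OF G that] by auto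
  obtain K where K: "clique G K" "card K = m"
    using extension_property_clique[OF G ext, of "{}" m] by auto
  have KV: "K \<subseteq> verts G" and finK: "finite K"
    using K(1) finG finite_subset by (auto simp: clique_def)
  obtain f where f: "bij_betw f {1..m} K"
    using finite_same_card_bij[OF _ finK, of "{1..m}"] K(2) by auto
  have edgesF0: "edges F0 \<subseteq> {e. e \<subseteq> {1..m} \<and> card e = 2}"
    using F0 by (simp add: weakly_saturated_def spanning_subgraph_def subgraph_def
        edges_complete_on)
  have f_edge: "f ` e \<in> edges G" if e: "e \<subseteq> {1..m}" "card e = 2" for e
  proof -
    obtain a b where ab: "e = {a, b}" "a \<noteq> b" using e(2) by (auto simp: card_2_iff)
    have "f a \<in> K" "f b \<in> K" "f a \<noteq> f b"
      using ab e(1) f by (auto simp: bij_betw_def dest: inj_onD)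
    then show ?thesis using K(1) ab(1) by (simp add: clique_def)
  qed
  define D0 where "D0 = (`) f ` edges F0"
  have finF0: "finite (edges F0)"
    using edgesF0 by (rule finite_subset) (auto intro: finite_subset[of _ "Pow {1..m}"])
  define A where "A = {a \<in> verts G. \<forall>k\<in>K. {k, a} \<in> edges G}"
  \<comment> \<open>For a vertex outside \<open>A\<close>, the clique is sought among the common
    neighbours of \<open>insert v K\<close>; adjacency to all of \<open>K\<close> is what puts it
    inside \<open>A\<close>.\<close>
  have "\<exists>U. card U = d - 1 \<and> (\<forall>u\<in>U. {v, u} \<in> edges G) \<and>
      (if v \<in> A then U \<subseteq> K else U \<subseteq> A \<and> clique G U)" if v: "v \<in> verts G - K" for v
  proof (cases "v \<in> A")
    case True
    have "d - 1 \<le> card K" using dh K(2) m h_def by simp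
    then obtain U where "U \<subseteq> K" "card U = d - 1" by (meson obtain_subset_with_card_n)
    then show ?thesis using True by (intro exI[of _ U]) (auto simp: A_def insert_commute)
  next
    case False
    have "card (insert v K) + (d - 1) \<le> m + 2 * card (verts H) + 2"
      using card_insert_le_m1[of "Suc m" K v] K(2) dh h_def by simp
    then obtain T where "clique G T" "card T = d - 1"
      "\<And>q t. q \<in> insert v K \<Longrightarrow> t \<in> T \<Longrightarrow> {q, t} \<in> edges G"
      using extension_property_clique[OF G ext, of "insert v K" "d - 1"] v KV by auto
    then show ?thesis using False by (intro exI[of _ T]) (auto simp: A_def clique_def)
  qed
  then obtain U where U: "\<And>v. v \<in> verts G - K \<Longrightarrow> card (U v) = d - 1"
      "\<And>v u. v \<in> verts G - K \<Longrightarrow> u \<in> U v \<Longrightarrow> {v, u} \<in> edges G"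
      "\<And>v. v \<in> verts G - K \<Longrightarrow> if v \<in> A then U v \<subseteq> K else U v \<subseteq> A \<and> clique G (U v)"
    by metis
  define D where "D = D0 \<union> (\<Union>v\<in>verts G - K. (\<lambda>u. {v, u}) ` U v)"
  have D0E: "D0 \<subseteq> edges G" using f_edge edgesF0 by (auto simp: D0_def)
  have DE: "D \<subseteq> edges G" using D0E U(2) by (auto simp: D_def)
  have finU: "finite (U v)" if "v \<in> verts G - K" for v
  proof -
    have "U v \<subseteq> verts G" using U(2)[OF that] inV by blast
    then show ?thesis using finG by (rule finite_subset)
  qed
  have "card D \<le> card D0 + card (\<Union>v\<in>verts G - K. (\<lambda>u. {v, u}) ` U v)"
    unfolding D_def by (rule card_Un_le)
  also have "card D0 \<le> card (edges F0)"
    unfolding D0_def by (rule card_image_le[OF finF0])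
  also have "card (\<Union>v\<in>verts G - K. (\<lambda>u. {v, u}) ` U v)
      \<le> (\<Sum>v\<in>verts G - K. card ((\<lambda>u. {v, u}) ` U v))"
    using finG by (intro card_UN_le) auto
  also have "\<dots> \<le> (\<Sum>v\<in>verts G - K. d - 1)"
    by (intro sum_mono) (metis U(1) card_image_le finU)
  also have "\<dots> = (d - 1) * (card (verts G) - m)"
    using card_Diff_subset[OF finK KV] K(2) by simp
  finally have cardD: "card D \<le> card (edges F0) + (d - 1) * (card (verts G) - m)" by simp

  let ?cl = "sat_closure G H D"
  note star = sat_closure_star[OF H G DE, folded d_def h_def]
  note cliq = sat_closure_clique[OF H G DE, folded h_def]
  have clU: "{v, u} \<in> ?cl" if "v \<in> verts G - K" "u \<in> U v" for v u
    by (rule sat_closure.base) (use that in \<open>auto simp: D_def\<close>)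
  have AK: "a \<notin> K" if "a \<in> A" for a
    using that loop by (auto simp: A_def)
  have AV: "A \<subseteq> verts G" by (auto simp: A_def)
  \<comment> \<open>The process of \<open>F0\<close> on the complete graph, transported along
    \<open>f\<close>.\<close>
  have cl_KK: "{a, b} \<in> ?cl" if ab: "a \<in> K" "b \<in> K" "a \<noteq> b" for a b
  proof -
    obtain i j where ij: "a = f i" "b = f j" "i \<in> {1..m}" "j \<in> {1..m}"
      using ab f by (auto simp: bij_betw_def)
    then have "{i, j} \<in> edges (complete_on m)"
      using ab(3) by (auto simp: pair_in_edges_complete_on)
    then have "{i, j} \<in> sat_closure (complete_on m) H (edges F0)"
      using weakly_saturated_imp_sat_closure[OF F0] by blast
    then have "f ` {i, j} \<in> sat_closure G H ((`) f ` edges F0)"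
      by (rule sat_closure_map[OF _ G])
        (use f KV f_edge in \<open>auto simp: edges_complete_on bij_betw_def\<close>)
    then show ?thesis
      using sat_closure_mono[of D0 D G H] ij by (auto simp: D_def D0_def)
  qed
  \<comment> \<open>The \<open>d - 1\<close> chosen edges from \<open>a\<close> to \<open>K\<close>
    are present and \<open>K\<close> is generated, so the star argument supplies each further
    edge.\<close>
  have cl_AK: "{a, w} \<in> ?cl" if a: "a \<in> A" and w: "w \<in> K" for a w
  proof (cases "w \<in> U a")
    case True
    then show ?thesis using clU[of a w] AK[OF a] AV a by blast
  next
    case False
    have a': "a \<in> verts G - K" using AK[OF a] AV a by blast
    have Ua: "U a \<subseteq> K" using U(3)[OF a'] a by simp
    show ?thesis
      by (rule star[OF KV _ _ _ Ua U(1)[OF a'] w False _ cl_KK clU[OF a']])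
        (use a' m K(2) a w in \<open>auto simp: h_def A_def insert_commute\<close>)
  qed
  \<comment> \<open>All pairs in \<open>insert b K\<close> are generated by now, and so are all
    edges from \<open>a\<close> to \<open>K\<close>; only \<open>{a, b}\<close> is missing.\<close>
  have cl_AA: "{a, b} \<in> ?cl" if ab: "a \<in> A" "b \<in> A" "{a, b} \<in> edges G" for a b
  proof (rule cliq[of "insert b K"])
    show "insert b K \<subseteq> verts G" "a \<in> verts G" "a \<notin> insert b K" "b \<in> insert b K"
      using ab AK AV KV loop by auto
    show "h - 1 \<le> card (insert b K)"
      using m K(2) card_insert_le[of K b] by (simp add: h_def)
    show "{c, e} \<in> ?cl" if "c \<in> insert b K" "e \<in> insert b K" "c \<noteq> e" for c e
      using that cl_KK cl_AK ab by (auto simp: insert_commute)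
    show "{a, u} \<in> ?cl" if "u \<in> insert b K" "u \<noteq> b" for u
      using that cl_AK ab by auto
  qed (use ab in auto)
  have cl_clique: "{a, b} \<in> ?cl" if "clique G T" "T \<subseteq> A" "a \<in> T" "b \<in> T" "a \<noteq> b" for T a b
    by (rule cl_AA) (use that in \<open>auto simp: clique_def\<close>)
  have common: "\<exists>T. clique G T \<and> T \<subseteq> A \<and> card T = h \<and> (\<forall>q\<in>Q. \<forall>t\<in>T. {q, t} \<in> edges G)"
    if Q: "Q \<subseteq> verts G" "card Q \<le> h + 2" for Q
  proof -
    have "card (Q \<union> K) + h \<le> m + 2 * card (verts H) + 2"
      using card_Un_le[of Q K] Q(2) K(2) by (simp add: h_def)
    then obtain T where T: "clique G T" "card T = h"
      "\<And>q t. q \<in> Q \<union> K \<Longrightarrow> t \<in> T \<Longrightarrow> {q, t} \<in> edges G"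
      using extension_property_clique[OF G ext, of "Q \<union> K" h] Q(1) KV by auto
    then show ?thesis
      by (intro exI[of _ T]) (auto simp: A_def clique_def)
  qed
  have cl_VA: "{v, w} \<in> ?cl" if v: "v \<in> verts G" and w: "w \<in> A" and vw: "{v, w} \<in> edges G" for v w
  proof -
    consider "v \<in> K" | "v \<in> A" | "v \<in> verts G - K" "v \<notin> A" using v by blast
    then show ?thesis
    proof cases
      case 1
      then show ?thesis using cl_AK[OF w, of v] by (simp add: insert_commute)
    next
      case 2
      then show ?thesis using cl_AA w vw by blast
    next
      case 3
      have Uv: "U v \<subseteq> A" "clique G (U v)" using U(3)[OF 3(1)] 3(2) by simp_all
      have sub: "{v, w} \<union> U v \<subseteq> verts G" using v w AV Uv(1) by auto
      have le: "card ({v, w} \<union> U v) \<le> h + 2"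
        using card_Un_le[of "{v, w}" "U v"] U(1)[OF 3(1)] dh card_insert_le_m1[of 2 "{w}" v] by simp
      from common[OF sub le] obtain T where T: "clique G T" "T \<subseteq> A" "card T = h"
          and QT: "\<forall>q\<in>{v, w} \<union> U v. \<forall>t\<in>T. {q, t} \<in> edges G"
        by (elim exE conjE) (rule that)
      note T = T QT[rule_format]
      have finT: "finite T" using finite_subset[OF T(2) finite_subset[OF AV finG]] .
      have "clique G (U v \<union> T)"
        using Uv(2) T(1,4) by (intro clique_Un) auto
      then have clUT: "{a, b} \<in> ?cl" if "a \<in> U v \<union> T" "b \<in> U v \<union> T" "a \<noteq> b" for a b
        using cl_clique[of "U v \<union> T"] that Uv(1) T(2) by auto
      \<comment> \<open>\<open>U v \<union> T\<close> is a clique inside \<open>A\<close>, hence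
        generated, and \<open>v\<close> already has its \<open>d - 1\<close> edges to
        \<open>U v\<close>. Passing through \<open>T\<close> is needed because \<open>w\<close> need
        not be adjacent to \<open>U v\<close>.\<close>
      have vt: "{v, t} \<in> ?cl" if t: "t \<in> T" for t
      proof (rule star[of "U v \<union> T" _ "U v"])
        show "t \<notin> U v" using T(4)[of t t] t loop by blast
        show "h - 1 \<le> card (U v \<union> T)"
          using T(3) card_mono[of "U v \<union> T" T] finU[OF 3(1)] finT by simp
      qed (use 3 U(1) clU clUT Uv T t AV v in auto)
      show ?thesis
      \<comment> \<open>Since \<open>w\<close> is in \<open>A\<close> and joined to all of
        \<open>T\<close>, the set \<open>insert w T\<close> is generated, and by \<open>vt\<close>
        only \<open>{v, w}\<close> is missing.\<close>
      proof (rule cliq[of "insert w T"])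
        show "h - 1 \<le> card (insert w T)"
          using T(3) card_insert_le[of T w] by simp
        show "{a, b} \<in> ?cl" if "a \<in> insert w T" "b \<in> insert w T" "a \<noteq> b" for a b
        proof (rule cl_AA)
          have "clique G ({w} \<union> T)"
            using T(1,4) w AV by (intro clique_Un) (auto simp: clique_def)
          then show "{a, b} \<in> edges G"
            using that by (auto simp: clique_def)
        qed (use that T(2) w in auto)
      qed (use v w vw vt T(2) AV 3(2) loop[OF vw] in auto)
    qed
  qed
  have "edges G \<subseteq> ?cl"
  proof
    fix e assume e: "e \<in> edges G"
    obtain v w where vw: "e = {v, w}"
      using simple_graph_edgeD(2)[OF G e] by (auto simp: card_2_iff)
    note vwE = e[unfolded vw]
    have sub: "{v, w} \<subseteq> verts G" using inV[OF vwE] by simp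
    have le: "card {v, w} \<le> h + 2" using card_insert_le_m1[of 2 "{w}" v] by simp
    \<comment> \<open>\<open>T\<close> consists of common neighbours of \<open>v\<close> and
      \<open>w\<close> in \<open>A\<close>, so its edges to both ends are generated by
      \<open>cl_VA\<close>.\<close>
    from common[OF sub le] obtain T where T: "clique G T" "T \<subseteq> A" "card T = h"
        and QT: "\<forall>q\<in>{v, w}. \<forall>t\<in>T. {q, t} \<in> edges G"
      by (elim exE conjE) (rule that)
    note T = T QT[rule_format]
    show "e \<in> ?cl"
      unfolding vw
    proof (rule cliq[of "insert w T"])
      show "h - 1 \<le> card (insert w T)"
        using T(3) card_insert_le[of T w] by simp
      show "v \<notin> insert w T" using loop[OF vwE] T(4)[of v v] loop[of v v] by auto
      show "{v, u} \<in> ?cl" if "u \<in> insert w T" "u \<noteq> w" for u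
        by (rule cl_VA) (use that inV[OF vwE] T in auto)
      have wT: "{w, t} \<in> ?cl" if "t \<in> T" for t
        by (rule cl_VA) (use that inV[OF vwE] T in auto)
      show "{a, b} \<in> ?cl" if "a \<in> insert w T" "b \<in> insert w T" "a \<noteq> b" for a b
        using that wT[of a] wT[of b] cl_clique[OF T(1,2)] by (auto simp: insert_commute)
    qed (use inV[OF vwE] vwE T(2) AV in auto)
  qed
  then show ?thesis
    using DE cardD card_mono[OF finG KV] K(2)
    by (intro that[of "(verts G, D)"])
      (auto simp: spanning_subgraph_def subgraph_def verts_def edges_def d_def)
qed

section \<open>Common neighbours in the binomial random graph\<close>

lemma prob_Pi_bernoulli_all:
  assumes "finite I" "0 \<le> p" "p \<le> 1"
  shows "measure_pmf.prob (Pi_pmf I False (\<lambda>_. bernoulli_pmf p)) {X. \<forall>e\<in>I. X e} = p ^ card I"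
proof -
  have "{X. \<forall>e\<in>I. X e} = Pi I (\<lambda>_. {True})" by auto
  then show ?thesis
    using assms by (simp add: measure_Pi_pmf_Pi measure_pmf_single)
qed

text \<open>Intersecting with the supports makes both factors countable without changing any
  probability.\<close>

lemma prob_pair_pmf_Times:
  "measure_pmf.prob (pair_pmf M N) (A \<times> B) = measure_pmf.prob M A * measure_pmf.prob N B"
proof -
  have "measure_pmf.prob (pair_pmf M N) (A \<times> B)
      = measure_pmf.prob (pair_pmf M N) ((A \<inter> set_pmf M) \<times> (B \<inter> set_pmf N))"
    using measure_Int_set_pmf[of "pair_pmf M N" "A \<times> B"] by (simp add: Times_Int_Times)
  also have "\<dots> = measure_pmf.prob M (A \<inter> set_pmf M) * measure_pmf.prob N (B \<inter> set_pmf N)"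
    by (intro measure_pmf_prob_product countable_Int2 countable_set_pmf)
  finally show ?thesis by (simp add: measure_Int_set_pmf)
qed

text \<open>Events on disjoint blocks of coordinates are independent; the induction splits off one
  block as a factor of a product measure.\<close>

lemma prob_Pi_bernoulli_blocks:
  assumes "finite Z" "\<And>z. z \<in> Z \<Longrightarrow> finite (I z)" "disjoint_family_on I Z" "0 \<le> p" "p \<le> 1"
  shows "measure_pmf.prob (Pi_pmf (\<Union>z\<in>Z. I z) False (\<lambda>_. bernoulli_pmf p))
           {X. \<forall>z\<in>Z. \<exists>e\<in>I z. \<not> X e} = (\<Prod>z\<in>Z. 1 - p ^ card (I z))"
  using assms(1-3)
proof (induction Z rule: finite_induct)
  case empty
  then show ?case by simp
next
  case (insert z Z)
  let ?P = "\<lambda>A. Pi_pmf A False (\<lambda>_. bernoulli_pmf p)"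
  let ?B = "\<Union>z\<in>Z. I z"
  have disj: "I z \<inter> ?B = {}"
    using insert.prems(2) insert.hyps(2) by (auto simp: disjoint_family_on_def)
  have "?P (\<Union>z\<in>insert z Z. I z)
      = map_pmf (\<lambda>(f, g) e. if e \<in> I z then f e else g e) (pair_pmf (?P (I z)) (?P ?B))"
    using Pi_pmf_union[of "I z" ?B False "\<lambda>_. bernoulli_pmf p"] insert disj by simp
  moreover have "(\<lambda>(f, g) e. if e \<in> I z then f e else g e) -` {X. \<forall>z\<in>insert z Z. \<exists>e\<in>I z. \<not> X e}
      = {X. \<exists>e\<in>I z. \<not> X e} \<times> {X. \<forall>z\<in>Z. \<exists>e\<in>I z. \<not> X e}"
    using disj by (auto; metis IntI UN_I empty_iff)
  moreover have "measure_pmf.prob (?P (I z)) {X. \<exists>e\<in>I z. \<not> X e} = 1 - p ^ card (I z)"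
  proof -
    have "{X. \<exists>e\<in>I z. \<not> X e} = UNIV - {X. \<forall>e\<in>I z. X e}" by auto
    then show ?thesis
      using measure_pmf.prob_compl[of "{X. \<forall>e\<in>I z. X e}" "?P (I z)"]
        prob_Pi_bernoulli_all[of "I z" p] insert.prems(1) assms(4,5) by simp
  qed
  moreover have "measure_pmf.prob (?P ?B) {X. \<forall>z\<in>Z. \<exists>e\<in>I z. \<not> X e} = (\<Prod>z\<in>Z. 1 - p ^ card (I z))"
    using insert.prems by (intro insert.IH) (auto simp: disjoint_family_on_def)
  ultimately show ?case
    using insert.hyps by (simp add: prob_pair_pmf_Times)
qed

lemma set_pmf_gnpD:
  assumes "G \<in> set_pmf (gnp n p)"
  shows "verts G = {1..n}" "edges G \<subseteq> edges (complete_on n)"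
  using assms by (auto simp: gnp_def verts_def edges_def)

text \<open>As \<open>z\<close> ranges outside \<open>Q\<close>, the stars from \<open>z\<close> to
  \<open>Q\<close> are pairwise disjoint sets of \<open>k\<close> edges, so the \<open>n - k\<close>
  failures are independent, each of probability \<open>1 - p ^ k\<close>.\<close>

lemma prob_no_common_neighbour:
  assumes Q: "Q \<subseteq> {1..n}" "card Q = k" and p: "0 \<le> p" "p \<le> 1"
  shows "measure_pmf.prob (Pi_pmf (edges (complete_on n)) False (\<lambda>_. bernoulli_pmf p))
           {X. \<forall>z\<in>{1..n} - Q. \<exists>e\<in>(\<lambda>q. {q, z}) ` Q. \<not> X e} = (1 - p ^ k) ^ (n - k)"
proof -
  let ?Z = "{1..n} - Q" and ?I = "\<lambda>z. (\<lambda>q. {q, z}) ` Q"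
  let ?E = "edges (complete_on n)" and ?P = "\<lambda>A. Pi_pmf A False (\<lambda>_. bernoulli_pmf p)"
  have finQ: "finite Q" using Q(1) finite_subset by blast
  have sub: "(\<Union>z\<in>?Z. ?I z) \<subseteq> ?E"
    using Q(1) by (auto simp: pair_in_edges_complete_on)
  have cardI: "card (?I z) = k" if "z \<in> ?Z" for z
  proof -
    have "inj_on (\<lambda>q. {q, z}) Q" using that by (auto simp: inj_on_def doubleton_eq_iff)
    then show ?thesis using Q(2) by (simp add: card_image)
  qed
  have "{X. \<forall>z\<in>?Z. \<exists>e\<in>?I z. \<not> X e}
      = (\<lambda>f x. if x \<in> (\<Union>z\<in>?Z. ?I z) then f x else False) -` {X. \<forall>z\<in>?Z. \<exists>e\<in>?I z. \<not> X e}"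
    by auto
  then have "measure_pmf.prob (?P ?E) {X. \<forall>z\<in>?Z. \<exists>e\<in>?I z. \<not> X e}
      = measure_pmf.prob (?P (\<Union>z\<in>?Z. ?I z)) {X. \<forall>z\<in>?Z. \<exists>e\<in>?I z. \<not> X e}"
    by (subst Pi_pmf_subset[OF finite_edges_complete_on sub]) simp
  also have "\<dots> = (\<Prod>z\<in>?Z. 1 - p ^ card (?I z))"
    using finQ p by (intro prob_Pi_bernoulli_blocks)
      (auto simp: disjoint_family_on_def doubleton_eq_iff)
  also have "\<dots> = (1 - p ^ k) ^ card ?Z"
    using cardI by simp
  also have "card ?Z = n - k"
    using card_Diff_subset[OF finQ Q(1)] Q(2) by simp
  finally show ?thesis .
qed

text \<open>A union bound over the sets of exactly \<open>k\<close> vertices: a smaller set without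
  a common neighbour extends to one of size \<open>k\<close>, which uses
  \<open>k \<le> n\<close>.\<close>

lemma prob_not_extension_property:
  assumes p: "0 \<le> p" "p \<le> 1" and n: "k \<le> n"
  shows "measure_pmf.prob (gnp n p) {G. \<not> extension_property k G} \<le> real n ^ k * (1 - p ^ k) ^ (n - k)"
proof -
  define g where "g = (\<lambda>X. ({1..n}, {e \<in> edges (complete_on n). X e}))"
  let ?P = "Pi_pmf (edges (complete_on n)) False (\<lambda>_. bernoulli_pmf p)"
  let ?Qs = "{Q. Q \<subseteq> {1..n} \<and> card Q = k}"
  let ?bad = "\<lambda>Q. {X. \<forall>z\<in>{1..n} - Q. \<exists>e\<in>(\<lambda>q. {q, z}) ` Q. \<not> X e}"
  have "g -` {G. \<not> extension_property k G} \<subseteq> (\<Union>Q\<in>?Qs. ?bad Q)"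
  proof
    fix X assume "X \<in> g -` {G. \<not> extension_property k G}"
    then obtain Q where Q: "Q \<subseteq> {1..n}" "card Q \<le> k"
        "\<And>z. z \<in> {1..n} \<Longrightarrow> \<exists>q\<in>Q. {q, z} \<in> edges (complete_on n) \<longrightarrow> \<not> X {q, z}"
      by (auto simp: extension_property_def g_def verts_def edges_def)
    obtain Q' where Q': "Q \<subseteq> Q'" "Q' \<subseteq> {1..n}" "card Q' = k"
      using exists_subset_between[of Q k "{1..n}"] Q n by auto
    have "\<exists>q\<in>Q'. \<not> X {q, z}" if z: "z \<in> {1..n} - Q'" for z
    proof -
      obtain q where q: "q \<in> Q" "{q, z} \<in> edges (complete_on n) \<longrightarrow> \<not> X {q, z}"
        using Q(3) z by blast
      have "{q, z} \<in> edges (complete_on n)"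
        using q(1) Q' z by (auto simp: pair_in_edges_complete_on)
      then show ?thesis using q Q'(1) by blast
    qed
    then show "X \<in> (\<Union>Q\<in>?Qs. ?bad Q)" using Q'(2,3) by (intro UN_I[of Q']) simp_all
  qed
  then have "measure_pmf.prob (gnp n p) {G. \<not> extension_property k G}
      \<le> measure_pmf.prob ?P (\<Union>Q\<in>?Qs. ?bad Q)"
    unfolding gnp_def g_def[symmetric] by (simp add: measure_pmf.finite_measure_mono)
  also have "\<dots> \<le> (\<Sum>Q\<in>?Qs. measure_pmf.prob ?P (?bad Q))"
    by (intro measure_pmf.finite_measure_subadditive_finite) auto
  also have "\<dots> = (\<Sum>Q\<in>?Qs. (1 - p ^ k) ^ (n - k))"
    by (intro sum.cong refl prob_no_common_neighbour) (use p in auto)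
  also have "\<dots> = real (n choose k) * (1 - p ^ k) ^ (n - k)"
    by (simp add: n_subsets)
  also have "\<dots> \<le> real n ^ k * (1 - p ^ k) ^ (n - k)"
    using binomial_le_pow[OF n] p
    by (intro mult_right_mono) (auto simp: power_le_one simp flip: of_nat_power)
  finally show ?thesis .
qed

section \<open>Decay of the error bound, and degree counting\<close>

lemma power_times_geometric_tendsto_0:
  fixes c :: real
  assumes "0 < c" "c < 1"
  shows "(\<lambda>n. real n ^ k * c ^ (n - k)) \<longlonglongrightarrow> 0"
proof -
  have "(\<lambda>n. real n ^ k * c ^ n / c ^ k) \<longlonglongrightarrow> 0"
    using assms by real_asymp
  moreover have "eventually (\<lambda>n. real n ^ k * c ^ n / c ^ k = real n ^ k * c ^ (n - k)) sequentially"
    using eventually_ge_at_top[of k] by eventually_elim (use assms in \<open>simp add: power_diff\<close>)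
  ultimately show ?thesis by (rule Lim_transform_eventually)
qed

text \<open>An edge between \<open>V - S\<close> and \<open>S\<close> determines which end lies in
  \<open>S\<close>, so summing degrees into \<open>S\<close> counts no edge twice.\<close>

lemma card_edges_ge_cross:
  assumes fin: "finite (edges G)" "finite V" "finite S"
    and deg: "\<And>v. v \<in> V - S \<Longrightarrow> k \<le> card {s \<in> S. adjacent G v s}"
  shows "k * card (V - S) \<le> card (edges G)"
proof -
  let ?P = "SIGMA v:V - S. {s \<in> S. adjacent G v s}"
  have "k * card (V - S) = (\<Sum>v\<in>V - S. k)" by simp
  also have "\<dots> \<le> (\<Sum>v\<in>V - S. card {s \<in> S. adjacent G v s})"
    using deg by (rule sum_mono)
  also have "\<dots> = card ?P"
    using fin by (intro card_SigmaI[symmetric]) auto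
  also have "\<dots> = card ((\<lambda>(v, s). {v, s}) ` ?P)"
    by (rule card_image[symmetric]) (auto simp: inj_on_def doubleton_eq_iff)
  also have "\<dots> \<le> card (edges G)"
    using fin(1) by (rule card_mono) (auto simp: adjacent_def)
  finally show ?thesis .
qed

lemma ex_vdegree_min_degree:
  assumes "simple_graph H" "no_isolated_vertices H"
  obtains x where "x \<in> verts H" "vdegree H x = min_degree H" "0 < vdegree H x"
proof -
  have "min_degree H \<in> vdegree H ` verts H"
    unfolding min_degree_def using assms(1) by (intro Min_in) (auto simp: simple_graph_def)
  then obtain x where x: "x \<in> verts H" "vdegree H x = min_degree H" by auto
  have "{u \<in> verts H. adjacent H x u} \<noteq> {}" "finite {u \<in> verts H. adjacent H x u}"
    using assms x(1) by (auto simp: no_isolated_vertices_def simple_graph_def)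
  then show ?thesis using that[OF x] by (auto simp: vdegree_def card_gt_0_iff)
qed

section \<open>Transfer to the random graph\<close>

text \<open>\<open>m\<close> minimises the excess \<open>E n - d * n\<close> over
  \<open>n \<ge> h\<close>. Shifting by \<open>b\<close> keeps the subtraction of naturals from
  truncating, so a least value exists and its minimality can be rearranged.\<close>

lemma ex_minimal_excess:
  fixes E :: "nat \<Rightarrow> nat"
  assumes "\<And>n. h \<le> n \<Longrightarrow> d * n \<le> E n + b"
  obtains m where "h \<le> m" "\<And>n. m \<le> n \<Longrightarrow> E m + d * (n - m) \<le> E n"
proof -
  obtain m where m: "h \<le> m" "\<And>n. h \<le> n \<Longrightarrow> E m + b - d * m \<le> E n + b - d * n"
    using ex_has_least_nat[of "\<lambda>n. h \<le> n" h "\<lambda>n. E n + b - d * n"] by auto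
  have "E m + d * (n - m) \<le> E n" if n: "m \<le> n" for n
    using m(2)[of n] assms[of m] assms[of n] m(1) n mult_le_mono2[OF n, of d]
    by (simp add: diff_mult_distrib2)
  then show ?thesis using that m(1) by blast
qed

theorem theorem1:
  fixes H :: "'h sgraph"
    and p C :: real
    and F0 :: "nat \<Rightarrow> nat sgraph"
    and S0 :: "nat \<Rightarrow> nat set"
  assumes "simple_graph H"
    and "no_isolated_vertices H"
    and "0 < p" and "p < 1"
    and "C > 0"
    and "\<And>n. n \<ge> 1 \<Longrightarrow> weakly_saturated (complete_on n) H (F0 n)"
    and "\<And>n. n \<ge> 1 \<Longrightarrow> S0 n \<subseteq> {1..n}"
    and "\<And>n. n \<ge> 1 \<Longrightarrow> real (card (S0 n)) \<le> C"
    and "\<And>n v. n \<ge> 1 \<Longrightarrow> v \<in> {1..n} - S0 n \<Longrightarrow>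
           card {s \<in> S0 n. adjacent (F0 n) v s} \<ge> min_degree H - 1"
  shows "(\<lambda>n. measure_pmf.prob (gnp n p)
            {G. \<exists>F. subgraph F G \<and> weakly_saturated G H F \<and>
                    card (edges F) = min (card (edges G)) (card (edges (F0 n)))})
         \<longlonglongrightarrow> 1"
proof -
  define h where "h = card (verts H)"
  define d where "d = min_degree H - 1"
  define c where "c = nat \<lfloor>C\<rfloor>"
  let ?good = "\<lambda>n. {G. \<exists>F. subgraph F G \<and> weakly_saturated G H F \<and>
      card (edges F) = min (card (edges G)) (card (edges (F0 n)))}"
  obtain x where x: "x \<in> verts H" "vdegree H x = min_degree H" "0 < vdegree H x"
    using ex_vdegree_min_degree[OF assms(1,2)] .
  have h1: "1 \<le> h"
    using assms(1) unfolding h_def simple_graph_def by (simp add: Suc_le_eq card_gt_0_iff)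
  \<comment> \<open>All but at most \<open>c\<close> vertices send \<open>d\<close> edges into
    \<open>S0 n\<close>, which bounds the excess from below by \<open>- d * c\<close>.\<close>
  have "d * n \<le> card (edges (F0 n)) + d * c" if n: "h \<le> n" for n
  proof -
    have n1: "n \<ge> 1" using n h1 by simp
    have "edges (F0 n) \<subseteq> edges (complete_on n)"
      using assms(6)[OF n1] by (simp add: weakly_saturated_def spanning_subgraph_def subgraph_def)
    then have "finite (edges (F0 n))" using finite_edges_complete_on finite_subset by blast
    then have "d * card ({1..n} - S0 n) \<le> card (edges (F0 n))"
      using assms(7,9)[OF n1] finite_subset unfolding d_def
      by (intro card_edges_ge_cross) auto
    moreover have "n \<le> card ({1..n} - S0 n) + c"
    proof -
      have "card (S0 n) \<le> c" using assms(8)[OF n1] by (simp add: c_def le_nat_floor)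
      then show ?thesis
        using assms(7)[OF n1] finite_subset[OF assms(7)[OF n1]] by (simp add: card_Diff_subset)
    qed
    then have "d * n \<le> d * card ({1..n} - S0 n) + d * c"
      by (metis add_mult_distrib2 mult_le_mono2)
    ultimately show ?thesis by linarith
  qed
  then obtain m where m: "h \<le> m"
      "\<And>n. m \<le> n \<Longrightarrow> card (edges (F0 m)) + d * (n - m) \<le> card (edges (F0 n))"
    using ex_minimal_excess[of h d "\<lambda>n. card (edges (F0 n))" "d * c"] by blast
  define k where "k = m + 2 * h + 2"
  have good: "G \<in> ?good n" if G: "G \<in> set_pmf (gnp n p)" "n \<ge> 1" "extension_property k G" for n G
  proof -
    have "simple_graph G"
      using set_pmf_gnpD[OF G(1)] G(2) by (auto simp: simple_graph_def edges_complete_on)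
    moreover have "weakly_saturated (complete_on m) H (F0 m)"
      using assms(6) m(1) h1 by simp
    ultimately obtain F where F: "spanning_subgraph F G" "edges G \<subseteq> sat_closure G H (edges F)"
        "m \<le> n" "card (edges F) \<le> card (edges (F0 m)) + d * (n - m)"
      using extension_property_saturated[OF assms(1) x(1,3), of G m "F0 m"] m(1) G(3)
        set_pmf_gnpD(1)[OF G(1)] unfolding k_def h_def d_def x(2) by auto
    have FG: "edges F \<subseteq> edges G" and finG: "finite (edges G)"
      using F(1) simple_graph_finite_edges[OF \<open>simple_graph G\<close>]
      by (auto simp: spanning_subgraph_def subgraph_def)
    \<comment> \<open>The choice of \<open>m\<close> makes the constructed graph no larger than
      \<open>F0 n\<close>; it is then padded with arbitrary edges of \<open>G\<close> to the exact
      size, and the closure only grows.\<close>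
    have "card (edges F) \<le> min (card (edges G)) (card (edges (F0 n)))"
      using F(4) m(2)[OF F(3)] card_mono[OF finG FG] by simp
    then obtain D where D: "edges F \<subseteq> D" "D \<subseteq> edges G"
        "card D = min (card (edges G)) (card (edges (F0 n)))"
      using exists_subset_between[OF _ _ FG finG] by (metis min.cobounded1)
    have span: "spanning_subgraph (verts G, D) G"
      using D(2) by (simp add: spanning_subgraph_def subgraph_def verts_def edges_def)
    have "weakly_saturated G H (verts G, D)"
      using sat_closure_imp_weakly_saturated[OF \<open>simple_graph G\<close> span] F(2)
        subset_trans[OF F(2) sat_closure_mono[OF D(1)]] by (simp add: edges_def)
    then show ?thesis
      using span D(3) by (auto simp: spanning_subgraph_def edges_def intro!: exI[of _ D])
  qed
  let ?b = "\<lambda>n. real n ^ k * (1 - p ^ k) ^ (n - k)"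
  have lower: "1 - ?b n \<le> measure_pmf.prob (gnp n p) (?good n)" if n: "n \<ge> max 1 k" for n
  proof -
    have "1 - measure_pmf.prob (gnp n p) (?good n) = measure_pmf.prob (gnp n p) (UNIV - ?good n)"
      using measure_pmf.prob_compl[of "?good n" "gnp n p"] by simp
    also have "\<dots> \<le> measure_pmf.prob (gnp n p) {G. \<not> extension_property k G}"
      \<comment> \<open>\<open>good\<close> covers only graphs in the support of
        \<open>gnp n p\<close>, hence the almost-everywhere comparison.\<close>
      using good[of _ n] n by (intro measure_pmf.finite_measure_mono_AE) (auto simp: AE_measure_pmf_iff)
    also have "\<dots> \<le> ?b n"
      using assms(3,4) n by (intro prob_not_extension_property) auto
    finally show ?thesis by simp
  qed
  have "k > 0" by (simp add: k_def)
  then have "0 < 1 - p ^ k" "1 - p ^ k < 1"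
    using assms(3,4) power_Suc_less_one[of p "k - 1"] by auto
  then have "(\<lambda>n. 1 - ?b n) \<longlonglongrightarrow> 1 - 0"
    by (intro tendsto_diff tendsto_const power_times_geometric_tendsto_0)
  then have lim: "(\<lambda>n. 1 - ?b n) \<longlonglongrightarrow> 1" by simp
  show ?thesis
  proof (rule tendsto_sandwich[OF _ _ lim tendsto_const])
    show "\<forall>\<^sub>F n in sequentially. 1 - ?b n \<le> measure_pmf.prob (gnp n p) (?good n)"
      using eventually_ge_at_top[of "max 1 k"] by eventually_elim (rule lower)
    show "\<forall>\<^sub>F n in sequentially. measure_pmf.prob (gnp n p) (?good n) \<le> 1" by simp
  qed
qed

end
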